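(* For $n\ge 0$ let $$\widetilde H_n(x)=(-1)^n e^{-x^2}\frac{d^n}{dx^n}e^{x^2},\qquad x\in\mathbb{R},$$ which is a polynomial in $x$. Then the function $w(x,t)=e^{t^2-2xt}$, $x,t\in\mathbb{R}$, is a generating function of the family $\{\widetilde H_n\}_{n\ge0}$, i.e. $w(x,t)=\sum_{n=0}^\infty \frac{\widetilde H_n(x)}{n!}t^n$, and the recurrence relation $$\widetilde H_{n+1}(x)+2x\widetilde H_n(x)-2n\widetilde H_{n-1}(x)=0,\quad n\ge1,\qquad \widetilde H_0(x)=1,\quad \widetilde H_{-1}(x)=0,$$ is satisfied (with $\widetilde H_{-1}:=0$). Let $$\widetilde{\mathcal O}=\frac{d^2}{dx^2}+2x\frac{d}{dx}.$$ Then $\widetilde{\mathcal O}$ is formally self-adjoint with respect to the inverse Gaussian measure $d\gamma_{-1}(x)=\pi^{1/2}e^{x^2}dx$ on $\mathbb{R}$. Moreover, $\widetilde{\mathcal O}\widetilde H_n(x)=2n\widetilde H_n(x)$ for all $n\ge0$.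
   Context: A second order differential operator $T$ on an open interval $I$ is formally self-adjoint with respect to a measure $\mu$ on $I$ if $\int_I (Tf)\,g\,d\mu=\int_I f\,(Tg)\,d\mu$ for all smooth functions $f,g$ with compact support in $I$. The generating function here is of exponential type (coefficients $\widetilde H_n(x)/n!$). *)

theory Defs
  imports "HOL-Analysis.Analysis" "HOL-Computational_Algebra.Polynomial"
begin

definition hermite_tilde :: "nat \<Rightarrow> real \<Rightarrow> real" where
  "hermite_tilde n x = (-1) ^ n * exp (- (x\<^sup>2)) * (deriv ^^ n) (\<lambda>u. exp (u\<^sup>2)) x"

text \<open>Extension to integer indices by zero, so that the convention for the index $-1$ can be stated
  (subtraction on \<^typ>\<open>nat\<close> truncates).\<close>

definition hermite_tilde_int :: "int \<Rightarrow> real \<Rightarrow> real" where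
  "hermite_tilde_int k x = (if k < 0 then 0 else hermite_tilde (nat k) x)"

definition hermite_op :: "(real \<Rightarrow> real) \<Rightarrow> real \<Rightarrow> real" where
  "hermite_op f x = deriv (deriv f) x + 2 * x * deriv f x"

definition inverse_gaussian :: "real measure" where
  "inverse_gaussian = density lborel (\<lambda>x. ennreal (sqrt pi * exp (x\<^sup>2)))"

text \<open>Smooth functions with compact support in an open set $I$, each identified with its extension by
  zero to the real line, which is again smooth.\<close>

definition test_functions :: "real set \<Rightarrow> (real \<Rightarrow> real) set" where
  "test_functions I = {f. (\<forall>n x. (deriv ^^ n) f differentiable (at x))
     \<and> compact (closure {x. f x \<noteq> 0}) \<and> closure {x. f x \<noteq> 0} \<subseteq> I}"

text \<open>The integrability clauses make explicit that both integrals exist; otherwise the Bochner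
  integral of a non-integrable function, which is 0 by convention, could make the equation hold
  vacuously.\<close>

definition formally_self_adjoint ::
    "real set \<Rightarrow> real measure \<Rightarrow> ((real \<Rightarrow> real) \<Rightarrow> real \<Rightarrow> real) \<Rightarrow> bool" where
  "formally_self_adjoint I \<mu> T \<longleftrightarrow>
     (\<forall>f\<in>test_functions I. \<forall>g\<in>test_functions I.
        set_integrable \<mu> I (\<lambda>x. T f x * g x) \<and>
        set_integrable \<mu> I (\<lambda>x. f x * T g x) \<and>
        (LINT x:I|\<mu>. T f x * g x) = (LINT x:I|\<mu>. f x * T g x))"

end

theory Submission
  imports Defs
begin

text \<open>
  Write $G_n$ for the polynomial that represents $\widetilde H_n$. Differentiating
  $(-1)^n G_n(x) e^{x^2}$ once more gives $G_{n+1} = -2x\,G_n - G_n'$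
  (\<open>hermite_tilde_eq_poly\<close>). Differentiating this relation in turn shows by induction
  that $G_n' = -2n\,G_{n-1}$ (\<open>pderiv_hermite_tilde_poly\<close>). These two identities carry the
  algebraic part: inserting the second into the first is the three-term recurrence, and
  $G_n'' + 2x\,G_n' = -2n\,(G_{n-1}' + 2x\,G_{n-1}) = 2n\,G_n$ is the eigenvalue equation.

  For the generating function, the formal series $W = e^{t^2} e^{-2xt}$ satisfies
  $W' = (2t - 2x)\,W$. On coefficients this is the three-term recurrence divided by $n!$, so the
  coefficients of $W$ are $\widetilde H_n(x)/n!$ (\<open>hermite_tilde_fps\<close>). Both factors
  converge absolutely for every real $t$, hence so does their Cauchy product, and its sum is
  $e^{t^2-2xt}$.

  Self-adjointness rests on the factor $e^{x^2}$ being the integrating factor of the operator: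
  $e^{x^2}\,\widetilde{\mathcal O} f = (e^{x^2} f')'$. Consequently
  $e^{x^2}(\widetilde{\mathcal O} f \cdot g - f \cdot \widetilde{\mathcal O} g)$ is the
  derivative of $e^{x^2}(f' g - f g')$ (\<open>hermite_op_lagrange_identity\<close>), and the derivative
  of a compactly supported function has integral zero.
\<close>

unbundle no vec_syntax and fps_syntax

section \<open>The polynomials behind the derivatives\<close>

fun hermite_tilde_poly :: "nat \<Rightarrow> real poly" where
  "hermite_tilde_poly 0 = 1"
| "hermite_tilde_poly (Suc n) = - ([:0, 2:] * hermite_tilde_poly n) - pderiv (hermite_tilde_poly n)"

lemma higher_deriv_exp_square:
  "(deriv ^^ n) (\<lambda>u::real. exp (u\<^sup>2)) =
     (\<lambda>x. (-1) ^ n * poly (hermite_tilde_poly n) x * exp (x\<^sup>2))"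
proof (induction n)
  case (Suc n)
  have "deriv (\<lambda>x::real. (-1) ^ n * poly (hermite_tilde_poly n) x * exp (x\<^sup>2)) x
      = (-1) ^ Suc n * poly (hermite_tilde_poly (Suc n)) x * exp (x\<^sup>2)" for x
    by (rule DERIV_imp_deriv)
      (auto intro!: derivative_eq_intros simp: algebra_simps)
  then show ?case using Suc by auto
qed simp

lemma hermite_tilde_eq_poly: "hermite_tilde n = poly (hermite_tilde_poly n)"
proof
  fix x :: real
  have "exp (- (x\<^sup>2)) * exp (x\<^sup>2) = 1" "(-1::real) ^ n * (-1) ^ n = 1"
    by (simp_all flip: exp_add power_mult_distrib)
  moreover have "hermite_tilde n x = ((-1) ^ n * (-1) ^ n) * (exp (- (x\<^sup>2)) * exp (x\<^sup>2))
      * poly (hermite_tilde_poly n) x"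
    unfolding hermite_tilde_def higher_deriv_exp_square by (simp only: mult_ac)
  ultimately show "hermite_tilde n x = poly (hermite_tilde_poly n) x"
    by simp
qed

text \<open>
  The lowering relation, obtained by differentiating $G_{n+2} = -2x\,G_{n+1} - G_{n+1}'$. The
  induction hypothesis turns the last two terms of the derivative into a multiple of
  $-2x\,G_n - G_n'$, which is $G_{n+1}$ again.
\<close>

lemma pderiv_hermite_tilde_poly:
  "pderiv (hermite_tilde_poly (Suc n)) = smult (- 2 * real (Suc n)) (hermite_tilde_poly n)"
proof (induction n)
  case 0
  show ?case by (simp add: pderiv_minus pderiv_pCons)
next
  case (Suc n)
  let ?G = "hermite_tilde_poly"
  have "pderiv (?G (Suc (Suc n))) =
      - smult 2 (?G (Suc n)) - [:0, 2:] * pderiv (?G (Suc n)) - pderiv (pderiv (?G (Suc n)))"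
    by (subst hermite_tilde_poly.simps(2))
      (simp add: pderiv_diff pderiv_minus pderiv_mult pderiv_pCons pderiv_smult
        del: hermite_tilde_poly.simps)
  also have "\<dots> = - smult 2 (?G (Suc n))
      - smult (2 * real (Suc n)) (- ([:0, 2:] * ?G n) - pderiv (?G n))"
    unfolding Suc
    by (simp add: poly_eq_poly_eq_iff[symmetric] fun_eq_iff pderiv_smult algebra_simps)
  also have "\<dots> = - smult 2 (?G (Suc n)) - smult (2 * real (Suc n)) (?G (Suc n))"
    by simp
  also have "\<dots> = smult (- 2 * real (Suc (Suc n))) (?G (Suc n))"
    by (simp only: flip: smult_add_left smult_minus_left smult_diff_left) (simp add: algebra_simps)
  finally show ?case .
qed

lemma hermite_tilde_poly_recurrence:
  "poly (hermite_tilde_poly (Suc (Suc n))) x =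
     2 * real (Suc n) * poly (hermite_tilde_poly n) x - 2 * x * poly (hermite_tilde_poly (Suc n)) x"
  by (subst hermite_tilde_poly.simps(2), subst pderiv_hermite_tilde_poly)
    (simp add: algebra_simps del: hermite_tilde_poly.simps)

text \<open>
  The operator factors as the lowering map $d/dx$ followed by $d/dx + 2x$, which is minus the raising
  map $G_m \<mapsto> G_{m+1}$.
\<close>

lemma hermite_op_hermite_tilde:
  "hermite_op (hermite_tilde n) x = 2 * real n * hermite_tilde n x"
proof -
  let ?G = "hermite_tilde_poly"
  have deriv_poly: "deriv (poly p) = poly (pderiv p)" for p :: "real poly"
    by (rule ext, rule DERIV_imp_deriv, rule poly_DERIV)
  have op: "hermite_op (hermite_tilde n) x = poly (pderiv (pderiv (?G n))) x + 2 * x * poly (pderiv (?G n)) x"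
    by (simp add: hermite_op_def hermite_tilde_eq_poly deriv_poly)
  show ?thesis
  proof (cases n)
    case 0
    then show ?thesis using op by simp
  next
    case (Suc m)
    have "hermite_op (hermite_tilde n) x
        = poly (pderiv (pderiv (?G (Suc m)))) x + 2 * x * poly (pderiv (?G (Suc m))) x"
      by (simp only: op flip: Suc)
    also have "\<dots> = - 2 * real (Suc m) * (poly (pderiv (?G m)) x + 2 * x * poly (?G m) x)"
      unfolding pderiv_hermite_tilde_poly by (simp add: pderiv_smult algebra_simps)
    also have "\<dots> = 2 * real (Suc m) * poly (?G (Suc m)) x"
      by (simp add: algebra_simps)
    finally show ?thesis
      by (simp only: Suc hermite_tilde_eq_poly)
  qed
qed

section \<open>The generating function\<close>

text \<open>
  The Taylor series of $e^{t^2}$. With its coefficients explicit, convergence follows from that of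
  the exponential series at $t^2$ by inserting zero terms.
\<close>

definition fps_exp_square :: "real fps" where
  "fps_exp_square = Abs_fps (\<lambda>n. if even n then 1 / fact (n div 2) else 0)"

lemma fps_deriv_exp_square: "fps_deriv fps_exp_square = 2 * fps_X * fps_exp_square"
proof (rule fps_ext)
  fix n
  show "fps_deriv fps_exp_square $ n = (2 * fps_X * fps_exp_square) $ n"
  proof (cases n)
    case (Suc m)
    have "(2 + 2 * real b) / ((1 + real b) * fact b) = 2 / fact b" for b
      by (simp add: divide_simps)
    then show ?thesis
      using Suc by (auto simp: fps_exp_square_def mult.assoc numeral_fps_const elim!: evenE)
  qed (simp add: fps_exp_square_def mult.assoc)
qed

lemma exp_square_sums: "(\<lambda>n. fps_exp_square $ n * t ^ n) sums exp (t\<^sup>2)"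
proof -
  have "(\<lambda>k. fps_exp_square $ (2 * k) * t ^ (2 * k)) sums exp (t\<^sup>2)"
    using exp_converges[of "t\<^sup>2"]
    by (simp add: fps_exp_square_def divide_inverse mult.commute flip: power_mult)
  then show ?thesis
    by (subst (asm) sums_mono_reindex)
      (auto simp: strict_mono_def fps_exp_square_def elim!: evenE)
qed

text \<open>
  Taking the coefficient of $t^{n+1}$ in $W' = 2tW - 2xW$ gives
  $(n+2)\,W_{n+2} = 2\,W_n - 2x\,W_{n+1}$, which is the recurrence of the $G_n(x)/n!$.
\<close>

lemma hermite_tilde_fps:
  "(fps_exp_square * fps_exp (- 2 * x)) $ n = poly (hermite_tilde_poly n) x / fact n"
proof (induction n rule: induct_nat_012)
  case 0
  show ?case by (simp add: fps_exp_square_def)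
next
  case 1
  show ?case by (simp add: fps_mult_nth fps_exp_square_def)
next
  case (ge2 n)
  let ?W = "fps_exp_square * fps_exp (- 2 * x)"
  have "fps_deriv ?W = fps_const 2 * (fps_X * ?W) - fps_const (2 * x) * ?W"
    by (simp add: fps_deriv_exp_square algebra_simps numeral_fps_const flip: fps_const_neg)
  then have "fps_deriv ?W $ Suc n = 2 * ?W $ n - 2 * x * ?W $ Suc n"
    by (simp only: fps_sub_nth fps_mult_left_const_nth fps_X_mult_nth nat.distinct if_False
        diff_Suc_1)
  moreover have "fps_deriv F $ Suc n = real (Suc (Suc n)) * F $ Suc (Suc n)" for F :: "real fps"
    by simp
  ultimately have step: "2 * ?W $ n - 2 * x * ?W $ Suc n = real (Suc (Suc n)) * ?W $ Suc (Suc n)"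
    by metis
  have "?W $ Suc (Suc n) = (2 * ?W $ n - 2 * x * ?W $ Suc n) / real (Suc (Suc n))"
    unfolding step by (rule nonzero_mult_div_cancel_left[symmetric]) simp
  also have "\<dots> = poly (hermite_tilde_poly (Suc (Suc n))) x / fact (Suc (Suc n))"
    unfolding ge2 hermite_tilde_poly_recurrence
    by (simp add: divide_simps del: hermite_tilde_poly.simps)
  finally show ?case .
qed

lemma hermite_tilde_generating_function:
  "(\<lambda>n. hermite_tilde n x / fact n * t ^ n) sums exp (t\<^sup>2 - 2 * x * t)"
proof -
  let ?a = "\<lambda>n. fps_exp_square $ n * t ^ n" and ?b = "\<lambda>n. fps_exp (- 2 * x) $ n * t ^ n"
  have b: "?b n = (- 2 * x * t) ^ n /\<^sub>R fact n" for n
    by (simp add: divide_inverse mult_ac flip: power_mult_distrib)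
  have "summable (\<lambda>n. norm (?a n))"
  proof -
    \<comment> \<open>The coefficients are nonnegative, so absolute convergence at $t$ is convergence at $|t|$.\<close>
    have "norm (?a n) = fps_exp_square $ n * \<bar>t\<bar> ^ n" for n
      by (simp add: abs_mult power_abs fps_exp_square_def)
    then show ?thesis
      using exp_square_sums[of "\<bar>t\<bar>"] by (simp add: sums_iff)
  qed
  moreover have "summable (\<lambda>n. norm (?b n))"
    using summable_norm_exp[of "- 2 * x * t"] by (simp only: b)
  ultimately have "(\<lambda>n. \<Sum>i\<le>n. ?a i * ?b (n - i)) sums ((\<Sum>n. ?a n) * (\<Sum>n. ?b n))"
    by (rule Cauchy_product_sums)
  moreover have "(\<Sum>n. ?a n) = exp (t\<^sup>2)"
    using exp_square_sums by (rule sums_unique[symmetric])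
  moreover have "(\<Sum>n. ?b n) = exp (- 2 * x * t)"
    using sums_unique[OF exp_converges[of "- 2 * x * t"]] by (simp only: b)
  moreover have "(\<Sum>i\<le>n. ?a i * ?b (n - i)) = hermite_tilde n x / fact n * t ^ n" for n
  proof -
    have "?a i * ?b (n - i) = fps_exp_square $ i * fps_exp (- 2 * x) $ (n - i) * t ^ n"
      if "i \<le> n" for i
      using that by (simp add: mult_ac flip: power_add)
    then have "(\<Sum>i\<le>n. ?a i * ?b (n - i)) = (fps_exp_square * fps_exp (- 2 * x)) $ n * t ^ n"
      unfolding fps_mult_nth atMost_atLeast0 sum_distrib_right by (intro sum.cong) auto
    then show ?thesis
      by (simp only: hermite_tilde_fps hermite_tilde_eq_poly)
  qed
  ultimately show ?thesis
    by (simp add: algebra_simps flip: exp_add)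
qed

section \<open>Formal self-adjointness\<close>

lemma integrable_lborel_compact_support:
  fixes h :: "real \<Rightarrow> real"
  assumes "continuous_on UNIV h" and "\<And>x. x \<notin> {a..b} \<Longrightarrow> h x = 0"
  shows "integrable lborel h"
proof -
  have "integrable lborel (\<lambda>x. indicator {a..b} x *\<^sub>R h x)"
    using assms(1) by (intro borel_integrable_compact) (auto intro: continuous_on_subset)
  moreover have "(\<lambda>x. indicator {a..b} x *\<^sub>R h x) = h"
    using assms(2) by (intro ext) (auto simp: indicator_def)
  ultimately show ?thesis by simp
qed

lemma integral_lborel_derivative_compact_support:
  fixes F h :: "real \<Rightarrow> real"
  assumes "\<And>x. (F has_real_derivative h x) (at x)" and "continuous_on UNIV h"
    and "a \<le> b" and "\<And>x. x \<notin> {a<..<b} \<Longrightarrow> F x = 0" and "\<And>x. x \<notin> {a..b} \<Longrightarrow> h x = 0"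
  shows "(\<integral>x. h x \<partial>lborel) = 0"
proof -
  have "(\<integral>x. h x * indicator {a..b} x \<partial>lborel) = F b - F a"
    using assms(1-3) by (intro integral_FTC_Icc_real) (auto simp: continuous_on_eq_continuous_at)
  moreover have "(\<lambda>x. h x * indicator {a..b} x) = h"
    using assms(5) by (intro ext) (auto simp: indicator_def)
  ultimately show ?thesis using assms(4) by simp
qed

lemma test_function_facts:
  assumes "f \<in> test_functions I"
  shows "(f has_real_derivative deriv f x) (at x)"
    and "(deriv f has_real_derivative deriv (deriv f) x) (at x)"
    and "continuous_on UNIV f" "continuous_on UNIV (deriv f)" "continuous_on UNIV (deriv (deriv f))"
proof -
  have "(deriv ^^ n) f differentiable (at x)" for n x
    using assms by (simp add: test_functions_def)
  from this[of 0] this[of 1] this[of 2]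
  have d: "f differentiable (at x)" "deriv f differentiable (at x)"
      "deriv (deriv f) differentiable (at x)" for x
    by (simp_all add: numeral_2_eq_2)
  show "(f has_real_derivative deriv f x) (at x)"
    and "(deriv f has_real_derivative deriv (deriv f) x) (at x)"
    using d by (simp_all add: DERIV_deriv_iff_real_differentiable)
  show "continuous_on UNIV f" "continuous_on UNIV (deriv f)" "continuous_on UNIV (deriv (deriv f))"
    using d by (auto intro!: continuous_at_imp_continuous_on differentiable_imp_continuous_within)
qed

lemma test_function_support_bounded:
  assumes "f \<in> test_functions I"
  obtains R where "\<And>x. R < \<bar>x\<bar> \<Longrightarrow> f x = 0"
proof -
  have "bounded {x. f x \<noteq> 0}"
    using assms bounded_subset closure_subset compact_imp_bounded
    by (auto simp: test_functions_def)
  then obtain R where "\<forall>x\<in>{x. f x \<noteq> 0}. norm x \<le> R"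
    by (auto simp: bounded_iff)
  then show ?thesis by (intro that[of R]) force
qed

text \<open>
  The identity behind the symmetry: differentiating the weight $e^{x^2}$ produces exactly the
  first-order terms $2x f'$ and $2x g'$ of the operator, while the products $f' g'$ cancel.
\<close>

lemma hermite_op_lagrange_identity:
  assumes "f \<in> test_functions I" "g \<in> test_functions J"
  shows "((\<lambda>x. exp (x\<^sup>2) * (deriv f x * g x - f x * deriv g x)) has_real_derivative
     exp (x\<^sup>2) * (hermite_op f x * g x - f x * hermite_op g x)) (at x)"
  unfolding hermite_op_def
  by (rule derivative_eq_intros test_function_facts[OF assms(1)] test_function_facts[OF assms(2)] refl)+
    (simp add: algebra_simps)

text \<open>
  The factor $\sqrt\pi$ in the measure is a constant, so the Lagrange identity for the weight
  $e^{x^2}$ gives the equality of the two integrals.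
\<close>

lemma formally_self_adjoint_hermite_op:
  "formally_self_adjoint UNIV inverse_gaussian hermite_op"
  unfolding formally_self_adjoint_def
proof (intro ballI)
  fix f g
  assume f: "f \<in> test_functions UNIV" and g: "g \<in> test_functions UNIV"
  obtain Rf Rg where "\<And>x. Rf < \<bar>x\<bar> \<Longrightarrow> f x = 0" "\<And>x. Rg < \<bar>x\<bar> \<Longrightarrow> g x = 0"
    using test_function_support_bounded f g by metis
  \<comment> \<open>The $+1$ makes both functions vanish at the end points $\pm R$ as well, so that the boundary
    terms of the fundamental theorem of calculus are zero.\<close>
  moreover define R where "R = max 0 (max Rf Rg) + 1"
  ultimately have R: "R > 0" "\<And>x. R \<le> \<bar>x\<bar> \<Longrightarrow> f x = 0" "\<And>x. R \<le> \<bar>x\<bar> \<Longrightarrow> g x = 0"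
    by auto
  have outside: "R \<le> \<bar>x\<bar>" if "x \<notin> {-R<..<R}" for x
    using that by auto
  note cont = test_function_facts(3-5)[OF f] test_function_facts(3-5)[OF g]
  let ?w = "\<lambda>x. sqrt pi * exp (x\<^sup>2)"
  define u where "u = (\<lambda>x. hermite_op f x * g x)"
  define v where "v = (\<lambda>x. f x * hermite_op g x)"
  have cu: "continuous_on UNIV u" and cv: "continuous_on UNIV v"
    unfolding u_def v_def hermite_op_def by (intro continuous_intros cont)+
  \<comment> \<open>Outside $[-R, R]$ the factor $g$ makes $u$ vanish, and the factor $f$ makes $v$ vanish.\<close>
  have ou: "u x = 0" and ov: "v x = 0" if "x \<notin> {-R..R}" for x
    using R(2,3) that unfolding u_def v_def by auto
  have density:
    "set_integrable inverse_gaussian UNIV h \<longleftrightarrow> integrable lborel (\<lambda>x. ?w x * h x)"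
    "(LINT x:UNIV|inverse_gaussian. h x) = (\<integral>x. ?w x * h x \<partial>lborel)"
    if "continuous_on UNIV h" for h :: "real \<Rightarrow> real"
    using borel_measurable_continuous_onI[OF that]
    unfolding set_integrable_def set_lebesgue_integral_def inverse_gaussian_def
    by (simp_all add: integrable_density integral_density)
  have iu: "integrable lborel (\<lambda>x. ?w x * u x)" and iv: "integrable lborel (\<lambda>x. ?w x * v x)"
    using cu cv ou ov
    by (intro integrable_lborel_compact_support[of _ "-R" R] continuous_intros; simp)+
  have "(\<integral>x. exp (x\<^sup>2) * (u x - v x) \<partial>lborel) = 0"
  proof (rule integral_lborel_derivative_compact_support)
    show "((\<lambda>x. exp (x\<^sup>2) * (deriv f x * g x - f x * deriv g x)) has_real_derivative
        exp (x\<^sup>2) * (u x - v x)) (at x)" for x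
      unfolding u_def v_def by (rule hermite_op_lagrange_identity[OF f g])
    show "continuous_on UNIV (\<lambda>x. exp (x\<^sup>2) * (u x - v x))"
      by (intro continuous_intros cu cv)
    show "- R \<le> R" using R(1) by simp
    show "exp (x\<^sup>2) * (deriv f x * g x - f x * deriv g x) = 0" if "x \<notin> {-R<..<R}" for x
      using R(2,3)[OF outside[OF that]] by simp
    show "exp (x\<^sup>2) * (u x - v x) = 0" if "x \<notin> {-R..R}" for x
      using ou[OF that] ov[OF that] by simp
  qed
  moreover have "(\<integral>x. ?w x * u x \<partial>lborel) - (\<integral>x. ?w x * v x \<partial>lborel)
      = (\<integral>x. sqrt pi * (exp (x\<^sup>2) * (u x - v x)) \<partial>lborel)"
    by (subst Bochner_Integration.integral_diff[OF iu iv, symmetric]) (simp add: algebra_simps)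
  ultimately have "(\<integral>x. ?w x * u x \<partial>lborel) = (\<integral>x. ?w x * v x \<partial>lborel)"
    by simp
  then have "set_integrable inverse_gaussian UNIV u \<and> set_integrable inverse_gaussian UNIV v \<and>
      (LINT x:UNIV|inverse_gaussian. u x) = (LINT x:UNIV|inverse_gaussian. v x)"
    unfolding density(1)[OF cu] density(1)[OF cv] density(2)[OF cu] density(2)[OF cv]
    using iu iv by blast
  then show "set_integrable inverse_gaussian UNIV (\<lambda>x. hermite_op f x * g x) \<and>
      set_integrable inverse_gaussian UNIV (\<lambda>x. f x * hermite_op g x) \<and>
      (LINT x:UNIV|inverse_gaussian. hermite_op f x * g x) =
      (LINT x:UNIV|inverse_gaussian. f x * hermite_op g x)"
    unfolding u_def v_def .
qed

theorem theorem1p1: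
  shows "(\<forall>n. \<exists>p :: real poly. \<forall>x. hermite_tilde n x = poly p x)
    \<and> (\<forall>x t :: real. (\<lambda>n. hermite_tilde n x / fact n * t ^ n) sums exp (t\<^sup>2 - 2 * x * t))
    \<and> (\<forall>n :: int. \<forall>x :: real. n \<ge> 1 \<longrightarrow>
         hermite_tilde_int (n + 1) x + 2 * x * hermite_tilde_int n x
           - 2 * of_int n * hermite_tilde_int (n - 1) x = 0)
    \<and> (\<forall>x. hermite_tilde_int 0 x = 1)
    \<and> (\<forall>x. hermite_tilde_int (-1) x = 0)
    \<and> formally_self_adjoint UNIV inverse_gaussian hermite_op
    \<and> (\<forall>n x. hermite_op (hermite_tilde n) x = 2 * real n * hermite_tilde n x)"
proof (intro conjI allI impI)
  show "\<exists>p :: real poly. \<forall>x. hermite_tilde n x = poly p x" for n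
    by (auto simp: hermite_tilde_eq_poly)
  show "hermite_tilde_int (n + 1) x + 2 * x * hermite_tilde_int n x
      - 2 * of_int n * hermite_tilde_int (n - 1) x = 0" if "n \<ge> 1" for n :: int and x :: real
  proof -
    define m where "m = nat (n - 1)"
    have n: "n = int m + 1" using that by (simp add: m_def)
    have "nat (n + 1) = Suc (Suc m)" "nat n = Suc m" "nat (n - 1) = m" "of_int n = real (Suc m)"
      using n by simp_all
    with that show ?thesis
      by (simp add: hermite_tilde_int_def hermite_tilde_eq_poly hermite_tilde_poly_recurrence
          del: hermite_tilde_poly.simps)
  qed
  show "hermite_tilde_int 0 x = 1" "hermite_tilde_int (-1) x = 0" for x
    by (simp_all add: hermite_tilde_int_def hermite_tilde_eq_poly)
qed (fact hermite_tilde_generating_function formally_self_adjoint_hermite_op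
      hermite_op_hermite_tilde)+

end
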